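(* Work in ZF. Suppose \(\Lambda\) is a family of sets, \(X=\bigcup\Lambda\), and \(\beta\) is an ordinal such that for every ordinal \(\alpha\le\beta\) there is an \(\alpha\)-descendingly closed fine filter on \(P(\Lambda)\) concentrating on the set of \(\sigma\subseteq\Lambda\) such that \(\bigcup\sigma\in\Lambda\). Then for any sequence \(\langle S_\xi:\xi<\beta\rangle\) of nonempty subsets of \(X\), there is a set \(A\in\Lambda\) such that \(S_\xi\cap A\neq\emptyset\) for all \(\xi<\beta\).
   Context: A filter \(F\) on \(P(\Lambda)\) is fine if for every \(x\in\Lambda\), \(\{\sigma\subseteq\Lambda: x\in\sigma\}\in F\). A filter is \(\alpha\)-descendingly closed if the intersection of any decreasing sequence \(\langle A_\iota:\iota<\alpha\rangle\) of its members is again a member. A filter concentrates on a set if that set belongs to the filter. *)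

theory Defs
  imports Main
begin

text \<open>
  HOL has a choice operator, so a theorem of choiceless set theory cannot be stated about HOL's
  own sets without silently working in the presence of choice.  "Work in ZF" is therefore
  rendered as "in every model of ZF": a structure is a type 'v with an arbitrary binary
  relation \<open>E\<close> (\<open>E x y\<close> read as "x is an element of y"), Separation and Replacement are the
  first-order schemas (one instance per formula, with parameters), and all set-theoretic notions
  are evaluated inside the structure.  Quantifiers over sets are quantifiers over 'v, so
  functions, filters, sequences, etc. are elements of the structure, not HOL objects.
\<close>

section \<open>First-order formulas of the language of set theory\<close>

datatype fm =
    FMem nat nat
  | FEq nat nat
  | FNeg fm
  | FConj fm fm
  | FEx nat fm

primrec sat :: "('v \<Rightarrow> 'v \<Rightarrow> bool) \<Rightarrow> (nat \<Rightarrow> 'v) \<Rightarrow> fm \<Rightarrow> bool" where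
  "sat E s (FMem i j) \<longleftrightarrow> E (s i) (s j)"
| "sat E s (FEq i j) \<longleftrightarrow> s i = s j"
| "sat E s (FNeg \<phi>) \<longleftrightarrow> \<not> sat E s \<phi>"
| "sat E s (FConj \<phi> \<psi>) \<longleftrightarrow> sat E s \<phi> \<and> sat E s \<psi>"
| "sat E s (FEx i \<phi>) \<longleftrightarrow> (\<exists>x. sat E (s(i := x)) \<phi>)"

section \<open>The axioms of ZF\<close>

definition ext :: "('v \<Rightarrow> 'v \<Rightarrow> bool) \<Rightarrow> 'v \<Rightarrow> 'v set" where
  "ext E x = {z. E z x}"

text \<open>
  In the two schemas variable 0 is the argument, variable 1 the value; the other variables are
  parameters, supplied by the assignment \<open>s\<close>.
\<close>

definition ZF_model :: "('v \<Rightarrow> 'v \<Rightarrow> bool) \<Rightarrow> bool" where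
  "ZF_model E \<longleftrightarrow>
     \<comment> \<open>Extensionality\<close>
     (\<forall>x y. ext E x = ext E y \<longrightarrow> x = y) \<and>
     \<comment> \<open>Foundation\<close>
     (\<forall>x. ext E x \<noteq> {} \<longrightarrow> (\<exists>y \<in> ext E x. ext E y \<inter> ext E x = {})) \<and>
     \<comment> \<open>Pairing\<close>
     (\<forall>x y. \<exists>z. ext E z = {x, y}) \<and>
     \<comment> \<open>Union\<close>
     (\<forall>x. \<exists>u. ext E u = (\<Union>y \<in> ext E x. ext E y)) \<and>
     \<comment> \<open>Power set\<close>
     (\<forall>x. \<exists>p. ext E p = {z. ext E z \<subseteq> ext E x}) \<and>
     \<comment> \<open>Infinity\<close>
     (\<exists>w. (\<exists>z \<in> ext E w. ext E z = {}) \<and>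
          (\<forall>x \<in> ext E w. \<exists>y \<in> ext E w. ext E y = insert x (ext E x))) \<and>
     \<comment> \<open>Separation\<close>
     (\<forall>\<phi> s a. \<exists>b. ext E b = {x \<in> ext E a. sat E (s(0 := x)) \<phi>}) \<and>
     \<comment> \<open>Replacement\<close>
     (\<forall>\<phi> s a.
        (\<forall>x \<in> ext E a. \<forall>y y'.
           sat E (s(0 := x, 1 := y)) \<phi> \<and> sat E (s(0 := x, 1 := y')) \<phi> \<longrightarrow> y = y') \<longrightarrow>
        (\<exists>b. ext E b = {y. \<exists>x \<in> ext E a. sat E (s(0 := x, 1 := y)) \<phi>}))"

section \<open>Set-theoretic notions inside a structure\<close>

text \<open>Kuratowski pairs: \<open>p = {{x}, {x, y}}\<close>.\<close>

definition is_opair :: "('v \<Rightarrow> 'v \<Rightarrow> bool) \<Rightarrow> 'v \<Rightarrow> 'v \<Rightarrow> 'v \<Rightarrow> bool" where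
  "is_opair E p x y \<longleftrightarrow> (\<exists>a b. ext E p = {a, b} \<and> ext E a = {x} \<and> ext E b = {x, y})"

definition rel_of :: "('v \<Rightarrow> 'v \<Rightarrow> bool) \<Rightarrow> 'v \<Rightarrow> ('v \<times> 'v) set" where
  "rel_of E f = {(x, y). \<exists>p. E p f \<and> is_opair E p x y}"

definition is_function_on :: "('v \<Rightarrow> 'v \<Rightarrow> bool) \<Rightarrow> 'v \<Rightarrow> 'v \<Rightarrow> bool" where
  "is_function_on E f d \<longleftrightarrow>
     (\<forall>p. E p f \<longrightarrow> (\<exists>x y. is_opair E p x y)) \<and>
     single_valued (rel_of E f) \<and> Domain (rel_of E f) = ext E d"

text \<open>Only meaningful when \<open>f\<close> is a function whose domain contains \<open>x\<close>.\<close>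

definition val :: "('v \<Rightarrow> 'v \<Rightarrow> bool) \<Rightarrow> 'v \<Rightarrow> 'v \<Rightarrow> 'v" where
  "val E f x = (THE y. (x, y) \<in> rel_of E f)"

text \<open>Von Neumann ordinals: transitive sets well-ordered by membership.\<close>

definition is_ordinal :: "('v \<Rightarrow> 'v \<Rightarrow> bool) \<Rightarrow> 'v \<Rightarrow> bool" where
  "is_ordinal E \<alpha> \<longleftrightarrow>
     (\<forall>x \<in> ext E \<alpha>. ext E x \<subseteq> ext E \<alpha>) \<and>
     (\<forall>x \<in> ext E \<alpha>. \<not> E x x) \<and>
     (\<forall>x \<in> ext E \<alpha>. \<forall>y \<in> ext E \<alpha>. \<forall>z \<in> ext E \<alpha>. E x y \<and> E y z \<longrightarrow> E x z) \<and>
     (\<forall>x \<in> ext E \<alpha>. \<forall>y \<in> ext E \<alpha>. E x y \<or> x = y \<or> E y x) \<and>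
     (\<forall>a. ext E a \<subseteq> ext E \<alpha> \<and> ext E a \<noteq> {} \<longrightarrow>
        (\<exists>m \<in> ext E a. \<forall>x \<in> ext E a. m = x \<or> E m x))"

text \<open>The class \<open>C\<close> is (the extension of) a set belonging to \<open>F\<close>.\<close>

definition class_in :: "('v \<Rightarrow> 'v \<Rightarrow> bool) \<Rightarrow> 'v set \<Rightarrow> 'v \<Rightarrow> bool" where
  "class_in E C F \<longleftrightarrow> (\<exists>A. E A F \<and> ext E A = C)"

section \<open>Filters on a power set\<close>

definition subsets :: "('v \<Rightarrow> 'v \<Rightarrow> bool) \<Rightarrow> 'v \<Rightarrow> 'v set" where
  "subsets E \<Lambda> = {\<sigma>. ext E \<sigma> \<subseteq> ext E \<Lambda>}"

text \<open>Filters are proper: the empty set is not a member.\<close>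

definition is_filter_on_Pow :: "('v \<Rightarrow> 'v \<Rightarrow> bool) \<Rightarrow> 'v \<Rightarrow> 'v \<Rightarrow> bool" where
  "is_filter_on_Pow E F \<Lambda> \<longleftrightarrow>
     (\<forall>A. E A F \<longrightarrow> ext E A \<subseteq> subsets E \<Lambda>) \<and>
     class_in E (subsets E \<Lambda>) F \<and>
     \<not> class_in E {} F \<and>
     (\<forall>A B. E A F \<and> ext E A \<subseteq> ext E B \<and> ext E B \<subseteq> subsets E \<Lambda> \<longrightarrow> E B F) \<and>
     (\<forall>A B. E A F \<and> E B F \<longrightarrow> class_in E (ext E A \<inter> ext E B) F)"

definition fine :: "('v \<Rightarrow> 'v \<Rightarrow> bool) \<Rightarrow> 'v \<Rightarrow> 'v \<Rightarrow> bool" where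
  "fine E F \<Lambda> \<longleftrightarrow> (\<forall>x \<in> ext E \<Lambda>. class_in E {\<sigma> \<in> subsets E \<Lambda>. E x \<sigma>} F)"

text \<open>
  The intersection is taken inside \<open>P(\<Lambda>)\<close>, so the empty sequence (\<open>\<alpha> = 0\<close>) has intersection
  \<open>P(\<Lambda>)\<close>.
\<close>

definition descendingly_closed ::
    "('v \<Rightarrow> 'v \<Rightarrow> bool) \<Rightarrow> 'v \<Rightarrow> 'v \<Rightarrow> 'v \<Rightarrow> bool" where
  "descendingly_closed E \<alpha> F \<Lambda> \<longleftrightarrow>
     (\<forall>f. is_function_on E f \<alpha> \<and>
          (\<forall>\<iota> \<in> ext E \<alpha>. E (val E f \<iota>) F) \<and>
          (\<forall>\<iota> \<in> ext E \<alpha>. \<forall>\<kappa> \<in> ext E \<alpha>. E \<iota> \<kappa> \<longrightarrow> ext E (val E f \<kappa>) \<subseteq> ext E (val E f \<iota>)) \<longrightarrow>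
          class_in E {\<sigma> \<in> subsets E \<Lambda>. \<forall>\<iota> \<in> ext E \<alpha>. E \<sigma> (val E f \<iota>)} F)"

end

theory Submission
  imports Defs
begin

text \<open>
  Induction on \<open>\<alpha> \<le> \<beta>\<close>: some member of \<open>\<Lambda>\<close> meets \<open>S\<^sub>\<xi>\<close> for all \<open>\<xi> < \<alpha>\<close>.  At a successor
  \<open>\<gamma> + 1\<close>, fineness gives a \<open>\<sigma>\<close> with \<open>\<Union>\<sigma> \<in> \<Lambda>\<close> that contains both a set good for \<open>\<gamma>\<close> and a
  set meeting \<open>S\<^sub>\<gamma>\<close>.  At a limit (or \<open>0\<close>), the sets \<open>B\<^sub>\<iota>\<close> of those \<open>\<sigma>\<close> whose union meets
  \<open>S\<^sub>\<xi>\<close> for all \<open>\<xi> < \<iota>\<close> decrease and, by fineness and the induction hypothesis, lie in the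
  filter; any \<open>\<sigma>\<close> in their intersection with \<open>\<Union>\<sigma> \<in> \<Lambda>\<close> works.  As \<open>E\<close> need not be externally
  well-founded, both the induction and the sequence \<open>B\<close> require explicit formulas.
\<close>

section \<open>Formulas\<close>

definition FAll :: "nat \<Rightarrow> fm \<Rightarrow> fm" where
  "FAll i \<phi> = FNeg (FEx i (FNeg \<phi>))"

definition FImp :: "fm \<Rightarrow> fm \<Rightarrow> fm" where
  "FImp \<phi> \<psi> = FNeg (FConj \<phi> (FNeg \<psi>))"

definition FIff :: "fm \<Rightarrow> fm \<Rightarrow> fm" where
  "FIff \<phi> \<psi> = FConj (FImp \<phi> \<psi>) (FImp \<psi> \<phi>)"

lemma sat_derived [simp]:
  "sat E s (FAll i \<phi>) \<longleftrightarrow> (\<forall>x. sat E (s(i := x)) \<phi>)"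
  "sat E s (FImp \<phi> \<psi>) \<longleftrightarrow> (sat E s \<phi> \<longrightarrow> sat E s \<psi>)"
  "sat E s (FIff \<phi> \<psi>) \<longleftrightarrow> (sat E s \<phi> \<longleftrightarrow> sat E s \<psi>)"
  by (auto simp: FAll_def FImp_def FIff_def)

text \<open>Variables from 20 on are reserved for the bound variables of the next two formulas.\<close>

definition F_upair :: "nat \<Rightarrow> nat \<Rightarrow> nat \<Rightarrow> fm" where
  "F_upair p x y =
     FAll 22 (FIff (FMem 22 p) (FNeg (FConj (FNeg (FEq 22 x)) (FNeg (FEq 22 y)))))"

definition F_opair :: "nat \<Rightarrow> nat \<Rightarrow> nat \<Rightarrow> fm" where
  "F_opair p x y =
     FEx 20 (FEx 21 (FConj (F_upair p 20 21) (FConj (F_upair 20 x x) (F_upair 21 x y))))"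

text \<open>The bound 22 only excludes capture by variable 22. It has to admit 20 and 21, which
  \<open>F_opair\<close> passes in as arguments.\<close>

lemma sat_F_upair [simp]:
  assumes "p < 22" "x < 22" "y < 22"
  shows "sat E s (F_upair p x y) \<longleftrightarrow> ext E (s p) = {s x, s y}"
  using assms by (auto simp: F_upair_def ext_def)

lemma sat_F_opair [simp]:
  assumes "p < 20" "x < 20" "y < 20"
  shows "sat E s (F_opair p x y) \<longleftrightarrow> is_opair E (s p) (s x) (s y)"
  using assms by (simp add: F_opair_def is_opair_def)

section \<open>Functions inside a model\<close>

lemma ZF_ext_inject:
  assumes "ZF_model E" "ext E x = ext E y"
  shows "x = y"
proof -
  have "\<forall>x y. ext E x = ext E y \<longrightarrow> x = y"
    using assms(1) unfolding ZF_model_def by (elim conjE)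
  with assms(2) show ?thesis by simp
qed

lemma ZF_upair:
  assumes "ZF_model E"
  shows "\<exists>z. ext E z = {x, y}"
proof -
  have "\<forall>x y. \<exists>z. ext E z = {x, y}"
    using assms unfolding ZF_model_def by (elim conjE)
  then show ?thesis by simp
qed

lemma ZF_Pow:
  assumes "ZF_model E"
  shows "\<exists>p. ext E p = subsets E x"
proof -
  have "\<forall>x. \<exists>p. ext E p = {z. ext E z \<subseteq> ext E x}"
    using assms unfolding ZF_model_def by (elim conjE)
  then show ?thesis by (simp add: subsets_def)
qed

lemma ZF_separation:
  assumes "ZF_model E"
  shows "\<exists>b. ext E b = {x \<in> ext E a. sat E (s(0 := x)) \<phi>}"
proof -
  have "\<forall>\<phi> s a. \<exists>b. ext E b = {x \<in> ext E a. sat E (s(0 := x)) \<phi>}"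
    using assms unfolding ZF_model_def by (elim conjE)
  then show ?thesis by simp
qed

lemma ZF_replacement:
  assumes "ZF_model E"
    and "\<And>x y y'. x \<in> ext E a \<Longrightarrow> sat E (s(0 := x, 1 := y)) \<phi> \<Longrightarrow>
           sat E (s(0 := x, 1 := y')) \<phi> \<Longrightarrow> y = y'"
  shows "\<exists>b. ext E b = {y. \<exists>x \<in> ext E a. sat E (s(0 := x, 1 := y)) \<phi>}"
proof -
  have "\<forall>\<phi> s a.
        (\<forall>x \<in> ext E a. \<forall>y y'.
           sat E (s(0 := x, 1 := y)) \<phi> \<and> sat E (s(0 := x, 1 := y')) \<phi> \<longrightarrow> y = y') \<longrightarrow>
        (\<exists>b. ext E b = {y. \<exists>x \<in> ext E a. sat E (s(0 := x, 1 := y)) \<phi>})"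
    using assms(1) unfolding ZF_model_def by (elim conjE)
  from this[rule_format, of a s \<phi>] assms(2) show ?thesis by blast
qed

lemma ZF_opair: "ZF_model E \<Longrightarrow> \<exists>p. is_opair E p x y"
  unfolding is_opair_def by (metis ZF_upair insert_absorb2)

lemma is_opair_unique:
  assumes "ZF_model E" "is_opair E p x y" "is_opair E q x y"
  shows "p = q"
  using assms unfolding is_opair_def by (metis ZF_ext_inject)

lemma is_opair_inject:
  assumes "is_opair E p x y" "is_opair E p x' y'"
  shows "x = x' \<and> y = y'"
proof -
  obtain a b a' b' where "ext E p = {a, b}" "ext E p = {a', b'}"
    and e: "ext E a = {x}" "ext E b = {x, y}" "ext E a' = {x'}" "ext E b' = {x', y'}"
    using assms unfolding is_opair_def by blast
  then have "{a, b} = {a', b'}"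
    by simp
  \<comment> \<open>Taking the image of both sides under \<open>ext E\<close> turns the internal
    codes into HOL sets of sets, where the usual Kuratowski argument applies.\<close>
  then have "{{x}, {x, y}} = {{x'}, {x', y'}}"
    using e by (metis image_empty image_insert)
  then show ?thesis
    by (auto simp: doubleton_eq_iff)
qed

lemma val_eqI: "single_valued (rel_of E f) \<Longrightarrow> (x, y) \<in> rel_of E f \<Longrightarrow> val E f x = y"
  unfolding val_def by (auto dest: single_valuedD)

text \<open>Formulas cannot express the description operator in \<open>val\<close>, but they can
  express \<open>rel_of\<close>; this equivalence is the bridge.\<close>

lemma rel_of_iff_val:
  assumes "is_function_on E f d" "x \<in> ext E d"
  shows "(x, y) \<in> rel_of E f \<longleftrightarrow> val E f x = y"
  using assms val_eqI unfolding is_function_on_def by (metis Domain_iff)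

text \<open>\<open>G\<close> is a HOL function, so something must make it visible to the model:
  \<phi> defines the pairs of its graph over \<open>a\<close>. Replacement applied to pairs rather
  than values yields the graph itself as a set.\<close>

lemma ZF_function:
  assumes ZF: "ZF_model E"
    and \<phi>: "\<And>x p. x \<in> ext E a \<Longrightarrow> sat E (s(0 := x, 1 := p)) \<phi> \<longleftrightarrow> is_opair E p x (G x)"
  shows "\<exists>f. is_function_on E f a \<and> (\<forall>x \<in> ext E a. val E f x = G x)"
proof -
  obtain f where f': "ext E f = {p. \<exists>x \<in> ext E a. sat E (s(0 := x, 1 := p)) \<phi>}"
  proof -
    have "\<exists>f. ext E f = {p. \<exists>x \<in> ext E a. sat E (s(0 := x, 1 := p)) \<phi>}"
    proof (rule ZF_replacement[OF ZF])
      fix x p q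
      assume "x \<in> ext E a" "sat E (s(0 := x, 1 := p)) \<phi>" "sat E (s(0 := x, 1 := q)) \<phi>"
      then show "p = q"
        using is_opair_unique[OF ZF, of p x "G x" q] \<phi> by simp
    qed
    with that show thesis
      by blast
  qed
  have f: "E p f \<longleftrightarrow> (\<exists>x \<in> ext E a. is_opair E p x (G x))" for p
  proof -
    have "E p f \<longleftrightarrow> p \<in> ext E f"
      by (simp add: ext_def)
    also have "\<dots> \<longleftrightarrow> (\<exists>x \<in> ext E a. is_opair E p x (G x))"
      unfolding f' using \<phi> by blast
    finally show ?thesis .
  qed
  have "(x, y) \<in> rel_of E f \<longleftrightarrow> x \<in> ext E a \<and> y = G x" for x y
    unfolding rel_of_def f mem_Collect_eq prod.case
  proof
    assume "\<exists>p. (\<exists>x \<in> ext E a. is_opair E p x (G x)) \<and> is_opair E p x y"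
    then obtain p x' where "x' \<in> ext E a" "is_opair E p x' (G x')" "is_opair E p x y"
      by blast
    then show "x \<in> ext E a \<and> y = G x"
      using is_opair_inject[of E p x' "G x'" x y] by auto
  next
    assume "x \<in> ext E a \<and> y = G x"
    then show "\<exists>p. (\<exists>x \<in> ext E a. is_opair E p x (G x)) \<and> is_opair E p x y"
      using ZF_opair[OF ZF, of x "G x"] by blast
  qed
  then have rel: "rel_of E f = {(x, G x) | x. x \<in> ext E a}"
    by auto
  then have sv: "single_valued (rel_of E f)"
    by (auto simp: single_valued_def)
  have "is_function_on E f a"
    unfolding is_function_on_def
  proof (intro conjI allI impI)
    show "\<exists>x y. is_opair E p x y" if "E p f" for p
      using f that by blast
    show "Domain (rel_of E f) = ext E a"
      unfolding rel by auto
  qed (fact sv)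
  moreover have "val E f x = G x" if "x \<in> ext E a" for x
    by (rule val_eqI[OF sv]) (use that in \<open>simp add: rel\<close>)
  ultimately show ?thesis by blast
qed

section \<open>Ordinals\<close>

lemma is_ordinalD:
  assumes "is_ordinal E \<alpha>"
  shows "x \<in> ext E \<alpha> \<Longrightarrow> ext E x \<subseteq> ext E \<alpha>"
    and "x \<in> ext E \<alpha> \<Longrightarrow> \<not> E x x"
    and "\<lbrakk>x \<in> ext E \<alpha>; y \<in> ext E \<alpha>; z \<in> ext E \<alpha>; E x y; E y z\<rbrakk> \<Longrightarrow> E x z"
    and "\<lbrakk>x \<in> ext E \<alpha>; y \<in> ext E \<alpha>\<rbrakk> \<Longrightarrow> E x y \<or> x = y \<or> E y x"
    and "\<lbrakk>ext E a \<subseteq> ext E \<alpha>; ext E a \<noteq> {}\<rbrakk> \<Longrightarrow> \<exists>m \<in> ext E a. \<forall>x \<in> ext E a. m = x \<or> E m x"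
proof -
  note o = assms[unfolded is_ordinal_def]
  show "x \<in> ext E \<alpha> \<Longrightarrow> ext E x \<subseteq> ext E \<alpha>"
    by (rule bspec[OF o[THEN conjunct1]])
  show "x \<in> ext E \<alpha> \<Longrightarrow> \<not> E x x"
    by (rule bspec[OF o[THEN conjunct2, THEN conjunct1]])
  show "\<lbrakk>x \<in> ext E \<alpha>; y \<in> ext E \<alpha>; z \<in> ext E \<alpha>; E x y; E y z\<rbrakk> \<Longrightarrow> E x z"
    using o[THEN conjunct2, THEN conjunct2, THEN conjunct1] by blast
  show "\<lbrakk>x \<in> ext E \<alpha>; y \<in> ext E \<alpha>\<rbrakk> \<Longrightarrow> E x y \<or> x = y \<or> E y x"
    using o[THEN conjunct2, THEN conjunct2, THEN conjunct2, THEN conjunct1] by blast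
  show "\<lbrakk>ext E a \<subseteq> ext E \<alpha>; ext E a \<noteq> {}\<rbrakk> \<Longrightarrow> \<exists>m \<in> ext E a. \<forall>x \<in> ext E a. m = x \<or> E m x"
    using o[THEN conjunct2, THEN conjunct2, THEN conjunct2, THEN conjunct2] by simp
qed

text \<open>Transitivity of \<gamma> as a set comes from transitivity of membership on \<alpha>; the
  other clauses are inherited by the subset \<gamma> of \<alpha>.\<close>

lemma is_ordinal_elem:
  assumes \<alpha>: "is_ordinal E \<alpha>" and \<gamma>: "\<gamma> \<in> ext E \<alpha>"
  shows "is_ordinal E \<gamma>"
proof -
  have sub: "ext E \<gamma> \<subseteq> ext E \<alpha>"
    using is_ordinalD(1)[OF \<alpha> \<gamma>] .
  have "ext E x \<subseteq> ext E \<gamma>" if x: "x \<in> ext E \<gamma>" for x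
  proof
    fix z assume z: "z \<in> ext E x"
    have "x \<in> ext E \<alpha>" "z \<in> ext E \<alpha>"
      using sub x z is_ordinalD(1)[OF \<alpha>, of x] by auto
    with is_ordinalD(3)[OF \<alpha>, of z x \<gamma>] x z \<gamma> show "z \<in> ext E \<gamma>"
      by (simp add: ext_def)
  qed
  moreover have "\<exists>m \<in> ext E a. \<forall>x \<in> ext E a. m = x \<or> E m x"
    if "ext E a \<subseteq> ext E \<gamma>" "ext E a \<noteq> {}" for a
    using is_ordinalD(5)[OF \<alpha>, of a] sub that by simp
  moreover have "\<forall>x \<in> ext E \<gamma>. \<not> E x x"
    using is_ordinalD(2)[OF \<alpha>] sub by blast
  moreover have "E x z"
    if "x \<in> ext E \<gamma>" "y \<in> ext E \<gamma>" "z \<in> ext E \<gamma>" "E x y \<and> E y z" for x y z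
    using is_ordinalD(3)[OF \<alpha>, of x y z] sub that by blast
  moreover have "E x y \<or> x = y \<or> E y x" if "x \<in> ext E \<gamma>" "y \<in> ext E \<gamma>" for x y
    using is_ordinalD(4)[OF \<alpha>, of x y] sub that by blast
  ultimately show ?thesis
    unfolding is_ordinal_def by (intro conjI ballI allI impI) metis+
qed

text \<open>Least elements exist only for sets of the model. Definability of \<open>P\<close> below
  \<beta> lets Separation collect the counterexamples into such a set, whose least element would
  contradict \<open>step\<close>; a last use of \<open>step\<close> reaches \<beta> itself.\<close>

lemma ordinal_induct_definable:
  assumes ZF: "ZF_model E" and "is_ordinal E \<beta>"
    and \<phi>: "\<And>\<alpha>. E \<alpha> \<beta> \<Longrightarrow> sat E (s(0 := \<alpha>)) \<phi> \<longleftrightarrow> P \<alpha>"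
    and step: "\<And>\<alpha>. is_ordinal E \<alpha> \<Longrightarrow> E \<alpha> \<beta> \<or> \<alpha> = \<beta> \<Longrightarrow> (\<And>\<gamma>. E \<gamma> \<alpha> \<Longrightarrow> P \<gamma>) \<Longrightarrow> P \<alpha>"
  shows "P \<beta>"
proof -
  obtain b where "ext E b = {\<alpha> \<in> ext E \<beta>. sat E (s(0 := \<alpha>)) (FNeg \<phi>)}"
    using ZF_separation[OF ZF] by blast
  then have b: "ext E b = {\<alpha> \<in> ext E \<beta>. \<not> P \<alpha>}"
    using \<phi> by (auto simp: ext_def)
  have "ext E b = {}"
  proof (rule ccontr)
    assume "ext E b \<noteq> {}"
    moreover have "ext E b \<subseteq> ext E \<beta>"
      using b by blast
    ultimately obtain m where m: "m \<in> ext E b" "\<And>x. x \<in> ext E b \<Longrightarrow> m = x \<or> E m x"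
      using is_ordinalD(5)[OF assms(2), of b] by blast
    have m\<beta>: "m \<in> ext E \<beta>"
      using m b by blast
    have "P \<gamma>" if "E \<gamma> m" for \<gamma>
    proof (rule ccontr)
      assume "\<not> P \<gamma>"
      moreover have \<gamma>: "\<gamma> \<in> ext E \<beta>"
        using that is_ordinalD(1)[OF assms(2) m\<beta>] by (auto simp: ext_def)
      ultimately have "m = \<gamma> \<or> E m \<gamma>"
        using m b by blast
      then show False
        using that m\<beta> is_ordinalD(2,3)[OF assms(2)] \<gamma> by blast
    qed
    then have "P m"
      using step[of m] is_ordinal_elem[OF assms(2) m\<beta>] m\<beta> by (auto simp: ext_def)
    then show False
      using m b by blast
  qed
  then show ?thesis
    using step[of \<beta>] assms(2) b by (auto simp: ext_def)
qed

section \<open>Meeting initial segments of the sequence\<close>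

text \<open>\<open>U\<close> is a HOL set so that the union of a \<sigma> can be used without first
  naming it as an element of the model.\<close>

definition meets :: "('v \<Rightarrow> 'v \<Rightarrow> bool) \<Rightarrow> 'v \<Rightarrow> 'v \<Rightarrow> 'v set \<Rightarrow> bool" where
  "meets E S \<alpha> U \<longleftrightarrow> (\<forall>\<xi> \<in> ext E \<alpha>. ext E (val E S \<xi>) \<inter> U \<noteq> {})"

lemma meets_mono: "meets E S \<alpha> U \<Longrightarrow> ext E \<gamma> \<subseteq> ext E \<alpha> \<Longrightarrow> U \<subseteq> V \<Longrightarrow> meets E S \<gamma> V"
  unfolding meets_def by blast

text \<open>This is the \<open>val\<close>-free form that \<open>F_meets\<close>
  transcribes.\<close>

lemma meets_iff_rel_of:
  assumes "is_function_on E S \<beta>" "ext E \<alpha> \<subseteq> ext E \<beta>"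
  shows "meets E S \<alpha> U \<longleftrightarrow>
    (\<forall>\<xi>. E \<xi> \<alpha> \<longrightarrow> (\<exists>y p. E p S \<and> is_opair E p \<xi> y \<and> (\<exists>x. E x y \<and> x \<in> U)))"
proof -
  have "ext E (val E S \<xi>) \<inter> U \<noteq> {} \<longleftrightarrow>
      (\<exists>y p. E p S \<and> is_opair E p \<xi> y \<and> (\<exists>x. E x y \<and> x \<in> U))" if "E \<xi> \<alpha>" for \<xi>
  proof -
    have "\<xi> \<in> ext E \<beta>"
      using that assms(2) by (auto simp: ext_def)
    from rel_of_iff_val[OF assms(1) this]
    have "(\<exists>p. E p S \<and> is_opair E p \<xi> y) \<longleftrightarrow> val E S \<xi> = y" for y
      by (simp add: rel_of_def)
    moreover have "ext E (val E S \<xi>) \<inter> U \<noteq> {} \<longleftrightarrow> (\<exists>x. E x (val E S \<xi>) \<and> x \<in> U)"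
      by (auto simp: ext_def)
    ultimately show ?thesis by metis
  qed
  then show ?thesis
    by (auto simp: meets_def ext_def)
qed

text \<open>Variable 2 is \<open>S\<close> and variables from 10 on are bound; \<open>\<chi>\<close> says that variable 10 is in \<open>U\<close>.\<close>

definition F_meets :: "nat \<Rightarrow> fm \<Rightarrow> fm" where
  "F_meets i \<chi> =
     FAll 11 (FImp (FMem 11 i) (FEx 12 (FEx 13 (FConj (FMem 13 2) (FConj (F_opair 13 11 12)
       (FEx 10 (FConj (FMem 10 12) \<chi>)))))))"

lemma sat_F_meets:
  assumes "is_function_on E (s 2) \<beta>" "ext E (s i) \<subseteq> ext E \<beta>" "i < 10"
    and "\<And>\<xi> y p x. sat E (s(11 := \<xi>, 12 := y, 13 := p, 10 := x)) \<chi> \<longleftrightarrow> x \<in> U"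
  shows "sat E s (F_meets i \<chi>) \<longleftrightarrow> meets E (s 2) (s i) U"
  using assms(3,4) by (simp add: F_meets_def meets_iff_rel_of[OF assms(1,2)])

lemma meets_sequence:
  assumes ZF: "ZF_model E" and S: "is_function_on E S \<beta>" and sub: "ext E \<alpha> \<subseteq> ext E \<beta>"
    and tr: "\<And>\<iota>. E \<iota> \<alpha> \<Longrightarrow> ext E \<iota> \<subseteq> ext E \<beta>"
  shows "\<exists>f. is_function_on E f \<alpha> \<and> (\<forall>\<iota> \<in> ext E \<alpha>. ext E (val E f \<iota>) =
           {\<sigma> \<in> subsets E \<Lambda>. meets E S \<iota> (\<Union>A \<in> ext E \<sigma>. ext E A)})"
proof -
  define C where "C \<iota> = {\<sigma> \<in> subsets E \<Lambda>. meets E S \<iota> (\<Union>A \<in> ext E \<sigma>. ext E A)}" for \<iota>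
  obtain P where P: "ext E P = subsets E \<Lambda>"
    using ZF_Pow[OF ZF] by blast
  \<comment> \<open>Variable 10 lies in the union of variable \<open>k\<close>. The set \<sigma> is
    variable 0 in the Separation instance and the bound variable 5 in the Replacement
    instance.\<close>
  define \<chi> where "\<chi> k = FEx 14 (FConj (FMem 14 k) (FMem 10 14))" for k
  have sat_\<chi>: "sat E s (F_meets i (\<chi> k)) \<longleftrightarrow> meets E S (s i) (\<Union>A \<in> ext E (s k). ext E A)"
    if "s 2 = S" "E (s i) \<alpha>" "i < 10" "k < 10" for s i k
    using sat_F_meets[of E s \<beta> i "\<chi> k" "\<Union>A \<in> ext E (s k). ext E A"] that S tr
    by (simp add: \<chi>_def ext_def)
  define s where "s = (\<lambda>_ :: nat. P)(2 := S)"
  have "\<exists>B. ext E B = C \<iota>" if "E \<iota> \<alpha>" for \<iota>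
  proof -
    obtain B where "ext E B = {\<sigma> \<in> ext E P. sat E (s(4 := \<iota>, 0 := \<sigma>)) (F_meets 4 (\<chi> 0))}"
      using ZF_separation[OF ZF] by blast
    then show ?thesis
      using that P by (auto simp: sat_\<chi> s_def C_def)
  qed
  \<comment> \<open>No choice is imposed on the model: by extensionality \<open>G\<close> is
    determined below \<alpha>, and the next formula defines its graph there.\<close>
  then obtain G where G: "\<And>\<iota>. E \<iota> \<alpha> \<Longrightarrow> ext E (G \<iota>) = C \<iota>"
    by metis
  let ?\<phi> = "FEx 4 (FConj (F_opair 1 0 4)
    (FAll 5 (FIff (FMem 5 4) (FConj (FMem 5 3) (F_meets 0 (\<chi> 5))))))"
  have "sat E (s(0 := \<iota>, 1 := p)) ?\<phi> \<longleftrightarrow> is_opair E p \<iota> (G \<iota>)" if "\<iota> \<in> ext E \<alpha>" for \<iota> p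
  proof -
    have \<iota>: "E \<iota> \<alpha>"
      using that by (simp add: ext_def)
    then have "sat E (s(0 := \<iota>, 1 := p)) ?\<phi> \<longleftrightarrow>
        (\<exists>B. is_opair E p \<iota> B \<and> (\<forall>\<sigma>. E \<sigma> B \<longleftrightarrow>
           E \<sigma> P \<and> meets E S \<iota> (\<Union>A \<in> ext E \<sigma>. ext E A)))"
      by (simp add: sat_\<chi> s_def)
    also have "\<dots> \<longleftrightarrow> (\<exists>B. is_opair E p \<iota> B \<and> ext E B = C \<iota>)"
      using P by (auto simp: C_def ext_def set_eq_iff)
    also have "\<dots> \<longleftrightarrow> is_opair E p \<iota> (G \<iota>)"
      using G[OF \<iota>] ZF_ext_inject[OF ZF] by metis
    finally show ?thesis .
  qed
  from ZF_function[OF ZF, of \<alpha> s ?\<phi> G, OF this] G show ?thesis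
    unfolding C_def by (fastforce simp: ext_def)
qed

section \<open>Filter properties stated for classes\<close>

lemma filter_Int:
  "is_filter_on_Pow E F \<Lambda> \<Longrightarrow> class_in E C F \<Longrightarrow> class_in E D F \<Longrightarrow> class_in E (C \<inter> D) F"
  unfolding is_filter_on_Pow_def class_in_def by blast

lemma filter_nonempty: "is_filter_on_Pow E F \<Lambda> \<Longrightarrow> class_in E C F \<Longrightarrow> C \<noteq> {}"
  unfolding is_filter_on_Pow_def by blast

lemma filter_up:
  "is_filter_on_Pow E F \<Lambda> \<Longrightarrow> class_in E C F \<Longrightarrow> C \<subseteq> ext E B \<Longrightarrow> ext E B \<subseteq> subsets E \<Lambda> \<Longrightarrow> E B F"
  unfolding is_filter_on_Pow_def class_in_def by blast

text \<open>It is enough to find a class in \<open>F\<close> all of whose \<sigma> have a union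
  meeting every required set: its intersection with the class in \<open>conc\<close> is nonempty
  because \<open>F\<close> is proper, and any \<sigma> in it supplies its union as the member of
  \<Lambda>.\<close>

lemma meets_step:
  assumes ZF: "ZF_model E" and S: "is_function_on E S \<beta>" and ord: "is_ordinal E \<alpha>"
    and sub: "ext E \<alpha> \<subseteq> ext E \<beta>"
    and S_meets: "\<And>\<xi>. E \<xi> \<alpha> \<Longrightarrow> \<exists>A. E A \<Lambda> \<and> ext E (val E S \<xi>) \<inter> ext E A \<noteq> {}"
    and filt: "is_filter_on_Pow E F \<Lambda>" and fine: "fine E F \<Lambda>"
    and closed: "descendingly_closed E \<alpha> F \<Lambda>"
    and conc: "class_in E {\<sigma> \<in> subsets E \<Lambda>. class_in E (\<Union>A \<in> ext E \<sigma>. ext E A) \<Lambda>} F"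
    and IH: "\<And>\<gamma>. E \<gamma> \<alpha> \<Longrightarrow> \<exists>A. E A \<Lambda> \<and> meets E S \<gamma> (ext E A)"
  shows "\<exists>A. E A \<Lambda> \<and> meets E S \<alpha> (ext E A)"
proof -
  have tr: "ext E \<iota> \<subseteq> ext E \<alpha>" if "E \<iota> \<alpha>" for \<iota>
    using is_ordinalD(1)[OF ord] that by (simp add: ext_def)
  have fineD: "class_in E {\<sigma> \<in> subsets E \<Lambda>. E A \<sigma>} F" if "E A \<Lambda>" for A
    using fine that unfolding fine_def by (auto simp: ext_def)
  have "\<exists>C. class_in E C F \<and> C \<subseteq> {\<sigma>. meets E S \<alpha> (\<Union>A \<in> ext E \<sigma>. ext E A)}"
  \<comment> \<open>The split is on whether \<alpha> has a largest element, so 0 goes with the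
    limits; there the sequence is empty and its intersection is all of
    \<open>subsets E \<Lambda>\<close>.\<close>
  proof (cases "\<exists>\<gamma> \<in> ext E \<alpha>. \<forall>\<iota> \<in> ext E \<alpha>. \<iota> = \<gamma> \<or> E \<iota> \<gamma>")
    case True
    then obtain \<gamma> where \<gamma>: "E \<gamma> \<alpha>" "\<And>\<iota>. \<iota> \<in> ext E \<alpha> \<Longrightarrow> \<iota> = \<gamma> \<or> \<iota> \<in> ext E \<gamma>"
      by (auto simp: ext_def)
    obtain A where A: "E A \<Lambda>" "meets E S \<gamma> (ext E A)"
      using IH \<gamma> by blast
    obtain A' where A': "E A' \<Lambda>" "ext E (val E S \<gamma>) \<inter> ext E A' \<noteq> {}"
      using S_meets \<gamma> by blast
    have "meets E S \<alpha> (\<Union>A \<in> ext E \<sigma>. ext E A)" if "E A \<sigma>" "E A' \<sigma>" for \<sigma>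
      unfolding meets_def
    proof
      fix \<xi> assume "\<xi> \<in> ext E \<alpha>"
      then have "\<xi> = \<gamma> \<or> \<xi> \<in> ext E \<gamma>"
        using \<gamma> by blast
      then have "ext E (val E S \<xi>) \<inter> (ext E A \<union> ext E A') \<noteq> {}"
        using A A' unfolding meets_def by blast
      moreover have "A \<in> ext E \<sigma>" "A' \<in> ext E \<sigma>"
        using that by (auto simp: ext_def)
      ultimately show "ext E (val E S \<xi>) \<inter> (\<Union>A \<in> ext E \<sigma>. ext E A) \<noteq> {}"
        by blast
    qed
    then show ?thesis
      using filter_Int[OF filt fineD[OF A(1)] fineD[OF A'(1)]] by blast
  next
    case False
    then have lim: "\<exists>\<kappa>. E \<kappa> \<alpha> \<and> E \<iota> \<kappa>" if "E \<iota> \<alpha>" for \<iota>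
      using is_ordinalD(4)[OF ord, of _ \<iota>] that by (auto simp: ext_def)
    obtain f where f: "is_function_on E f \<alpha>" "\<And>\<iota>. E \<iota> \<alpha> \<Longrightarrow> ext E (val E f \<iota>) =
           {\<sigma> \<in> subsets E \<Lambda>. meets E S \<iota> (\<Union>A \<in> ext E \<sigma>. ext E A)}"
      using meets_sequence[OF ZF S sub, of \<Lambda>] tr sub by (auto simp: ext_def)
    have inF: "E (val E f \<iota>) F" if \<iota>: "E \<iota> \<alpha>" for \<iota>
    proof -
      obtain A where A: "E A \<Lambda>" "meets E S \<iota> (ext E A)"
        using IH \<iota> by blast
      \<comment> \<open>If \<open>A\<close> belongs to \<sigma>, the union of \<sigma> includes
        \<open>A\<close> and so meets whatever \<open>A\<close> meets.\<close>
      have "{\<sigma> \<in> subsets E \<Lambda>. E A \<sigma>} \<subseteq> ext E (val E f \<iota>)"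
        unfolding f(2)[OF \<iota>] by (auto intro!: meets_mono[OF A(2)] simp: ext_def)
      then show ?thesis
        using filter_up[OF filt fineD[OF A(1)]] f(2)[OF \<iota>] by blast
    qed
    have decr: "ext E (val E f \<kappa>) \<subseteq> ext E (val E f \<iota>)" if "E \<iota> \<alpha>" "E \<kappa> \<alpha>" "E \<iota> \<kappa>" for \<iota> \<kappa>
    proof -
      have "ext E \<iota> \<subseteq> ext E \<kappa>"
        using is_ordinalD(1)[OF is_ordinal_elem[OF ord]] that by (simp add: ext_def)
      then show ?thesis
        using f(2) that meets_mono[of E S \<kappa> _ \<iota>] by auto
    qed
    have "class_in E {\<sigma> \<in> subsets E \<Lambda>. \<forall>\<iota> \<in> ext E \<alpha>. E \<sigma> (val E f \<iota>)} F"
      using closed f(1) inF decr unfolding descendingly_closed_def by (simp add: ext_def)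
    moreover have "meets E S \<alpha> (\<Union>A \<in> ext E \<sigma>. ext E A)"
      if \<sigma>: "\<forall>\<iota> \<in> ext E \<alpha>. E \<sigma> (val E f \<iota>)" for \<sigma>
      unfolding meets_def
    proof
      fix \<xi> assume "\<xi> \<in> ext E \<alpha>"
      \<comment> \<open>The set indexed by \<kappa> controls only indices strictly below \<kappa>,
        so \<xi> must first be placed below some \<kappa> in \<alpha>.\<close>
      then obtain \<kappa> where \<kappa>: "E \<kappa> \<alpha>" "E \<xi> \<kappa>"
        using lim by (auto simp: ext_def)
      then have "\<sigma> \<in> ext E (val E f \<kappa>)"
        using \<sigma> by (simp add: ext_def)
      then have "meets E S \<kappa> (\<Union>A \<in> ext E \<sigma>. ext E A)"
        using f(2)[OF \<kappa>(1)] by simp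
      then show "ext E (val E S \<xi>) \<inter> (\<Union>A \<in> ext E \<sigma>. ext E A) \<noteq> {}"
        using \<kappa> unfolding meets_def by (simp add: ext_def)
    qed
    ultimately show ?thesis by blast
  qed
  then obtain C where C: "class_in E C F" "C \<subseteq> {\<sigma>. meets E S \<alpha> (\<Union>A \<in> ext E \<sigma>. ext E A)}"
    by blast
  from filter_nonempty[OF filt filter_Int[OF filt C(1) conc]] C(2)
  obtain \<sigma> where "meets E S \<alpha> (\<Union>A \<in> ext E \<sigma>. ext E A)"
      "class_in E (\<Union>A \<in> ext E \<sigma>. ext E A) \<Lambda>"
    by blast
  then show ?thesis
    unfolding class_in_def by metis
qed

theorem theorem2p21:
  fixes E :: "'v \<Rightarrow> 'v \<Rightarrow> bool" and \<Lambda> X \<beta> S :: 'v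
  assumes "ZF_model E"
    and "ext E X = (\<Union>A \<in> ext E \<Lambda>. ext E A)"
    and "is_ordinal E \<beta>"
    and "\<And>\<alpha>. is_ordinal E \<alpha> \<Longrightarrow> E \<alpha> \<beta> \<or> \<alpha> = \<beta> \<Longrightarrow>
           \<exists>F. is_filter_on_Pow E F \<Lambda> \<and> fine E F \<Lambda> \<and> descendingly_closed E \<alpha> F \<Lambda> \<and>
               class_in E {\<sigma> \<in> subsets E \<Lambda>. class_in E (\<Union>A \<in> ext E \<sigma>. ext E A) \<Lambda>} F"
    and "is_function_on E S \<beta>"
    and "\<And>\<xi>. E \<xi> \<beta> \<Longrightarrow> ext E (val E S \<xi>) \<noteq> {} \<and> ext E (val E S \<xi>) \<subseteq> ext E X"
  shows "\<exists>A. E A \<Lambda> \<and> (\<forall>\<xi>. E \<xi> \<beta> \<longrightarrow> ext E (val E S \<xi>) \<inter> ext E A \<noteq> {})"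
proof -
  have tr: "ext E \<alpha> \<subseteq> ext E \<beta>" if "E \<alpha> \<beta> \<or> \<alpha> = \<beta>" for \<alpha>
    using is_ordinalD(1)[OF assms(3), of \<alpha>] that by (auto simp: ext_def)
  \<comment> \<open>Any element of the nonempty set at \<xi> lies in \<open>X\<close>, the union of
    \<Lambda>, hence in some member of \<Lambda>.\<close>
  have S_meets: "\<exists>A. E A \<Lambda> \<and> ext E (val E S \<xi>) \<inter> ext E A \<noteq> {}" if "E \<xi> \<beta>" for \<xi>
    using assms(2) assms(6)[OF that] unfolding ext_def by blast
  define s where "s = (\<lambda>_ :: nat. \<Lambda>)(2 := S)"
  \<comment> \<open>Variable 0 is the ordinal, 4 the witness \<open>A\<close>, and 3 has the default
    value \<Lambda>.\<close>
  let ?\<phi> = "FEx 4 (FConj (FMem 4 3) (F_meets 0 (FMem 10 4)))"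
  have "\<exists>A. E A \<Lambda> \<and> meets E S \<beta> (ext E A)"
  proof (rule ordinal_induct_definable[OF assms(1,3), where s = s and \<phi> = ?\<phi>])
    fix \<alpha> assume "E \<alpha> \<beta>"
    then have "sat E (s(0 := \<alpha>, 4 := A)) (F_meets 0 (FMem 10 4)) \<longleftrightarrow> meets E S \<alpha> (ext E A)" for A
      using sat_F_meets[of E "s(0 := \<alpha>, 4 := A)" \<beta> 0 "FMem 10 4" "ext E A"] assms(5) tr
      by (simp add: s_def ext_def)
    then show "sat E (s(0 := \<alpha>)) ?\<phi> \<longleftrightarrow> (\<exists>A. E A \<Lambda> \<and> meets E S \<alpha> (ext E A))"
      by (simp add: s_def)
  next
    fix \<alpha>
    assume \<alpha>: "is_ordinal E \<alpha>" "E \<alpha> \<beta> \<or> \<alpha> = \<beta>"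
      and IH: "\<And>\<gamma>. E \<gamma> \<alpha> \<Longrightarrow> \<exists>A. E A \<Lambda> \<and> meets E S \<gamma> (ext E A)"
    \<comment> \<open>The filter is taken afresh for this one \<alpha>; no sequence of filters is
      ever formed in the model.\<close>
    from assms(4)[OF \<alpha>] obtain F where F: "is_filter_on_Pow E F \<Lambda>" "fine E F \<Lambda>"
        "descendingly_closed E \<alpha> F \<Lambda>"
        "class_in E {\<sigma> \<in> subsets E \<Lambda>. class_in E (\<Union>A \<in> ext E \<sigma>. ext E A) \<Lambda>} F"
      by blast
    have "E \<xi> \<beta>" if "E \<xi> \<alpha>" for \<xi>
      using tr[OF \<alpha>(2)] that by (auto simp: ext_def)
    with S_meets show "\<exists>A. E A \<Lambda> \<and> meets E S \<alpha> (ext E A)"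
      by (intro meets_step[OF assms(1,5) \<alpha>(1) tr[OF \<alpha>(2)] _ F IH]) blast+
  qed
  then show ?thesis
    by (simp add: meets_def ext_def)
qed

end
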